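(* Let $\mathfrak{A}=(A;\vee,\wedge,\odot,\rightarrow,0,1)$ be a residuated lattice. The following assertions are equivalent: (1) $\mathfrak{A}$ is Gelfand; (2) for any $a,b\in A$ with $a\odot b=0$, there exist positive integers $m,n$ such that $\neg a^m\vee \neg b^n=1$.
   Context: A residuated lattice is an algebra $\mathfrak{A}=(A;\vee,\wedge,\odot,\rightarrow,0,1)$ such that $(A;\vee,\wedge,0,1)$ is a bounded lattice, $(A;\odot,1)$ is a commutative monoid, and $x\odot y\le z$ iff $x\le y\rightarrow z$ for all $x,y,z\in A$. Put $\neg a:=a\rightarrow 0$, $a^1=a$, $a^{n+1}=a^n\odot a$; the expression $\neg a^m$ means $\neg(a^m)$. A filter of $\mathfrak{A}$ is a non-empty subset $F\subseteq A$ such that $x,y\in F$ implies $x\odot y\in F$, and $x\in F$, $y\in A$ imply $x\vee y\in F$. A filter is proper if it is not $A$; a maximal filter is a maximal element (under inclusion) among proper filters; a prime filter is a proper filter $\mathfrak{p}$ such that $x\vee y\in\mathfrak{p}$ implies $x\in\mathfrak{p}$ or $y\in\mathfrak{p}$. $\mathfrak{A}$ is Gelfand if every prime filter is contained in a unique maximal filter. *)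

theory Defs
  imports Main
begin

text \<open>
  The carrier is the whole type, with \<open>inf\<close>, \<open>sup\<close>, \<open>bot\<close> for the lattice operations and the
  least element, and \<open>*\<close>, \<open>1\<close> and \<open>^\<close> for the commutative monoid and its powers.
  The axiom \<open>one_eq_top\<close> identifies the monoid unit with the greatest element. The degenerate
  case \<open>bot = 1\<close> is allowed.
\<close>

class residuated_lattice = bounded_lattice + comm_monoid_mult +
  fixes residual :: "'a \<Rightarrow> 'a \<Rightarrow> 'a"  (infixr "\<rightarrow>" 60)
  assumes one_eq_top: "1 = top"
    and residuation: "x * y \<le> z \<longleftrightarrow> x \<le> y \<rightarrow> z"

definition neg :: "'a::residuated_lattice \<Rightarrow> 'a" where
  "neg a = a \<rightarrow> bot"

definition rl_filter :: "'a::residuated_lattice set \<Rightarrow> bool" where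
  "rl_filter F \<longleftrightarrow> F \<noteq> {} \<and> (\<forall>x\<in>F. \<forall>y\<in>F. x * y \<in> F) \<and> (\<forall>x\<in>F. \<forall>y. sup x y \<in> F)"

definition proper_filter :: "'a::residuated_lattice set \<Rightarrow> bool" where
  "proper_filter F \<longleftrightarrow> rl_filter F \<and> F \<noteq> UNIV"

definition maximal_filter :: "'a::residuated_lattice set \<Rightarrow> bool" where
  "maximal_filter M \<longleftrightarrow> proper_filter M \<and> (\<forall>F. proper_filter F \<and> M \<subseteq> F \<longrightarrow> F = M)"

definition prime_filter :: "'a::residuated_lattice set \<Rightarrow> bool" where
  "prime_filter P \<longleftrightarrow> proper_filter P \<and> (\<forall>x y. sup x y \<in> P \<longrightarrow> x \<in> P \<or> y \<in> P)"

text \<open>The argument only selects the residuated lattice, i.e. the type \<open>'a\<close>.\<close>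

definition gelfand :: "'a::residuated_lattice itself \<Rightarrow> bool" where
  "gelfand _ \<longleftrightarrow>
     (\<forall>P :: 'a set. prime_filter P \<longrightarrow> (\<exists>!M. maximal_filter M \<and> P \<subseteq> M))"

end

theory Submission
  imports Defs
begin

text \<open>
  Two elements \<open>a\<close> and \<open>b\<close> with \<open>a * b = bot\<close> cannot lie in a common proper filter. Hence both
  sides of the equivalence speak about separation: distinct maximal filters are separated by such
  a pair, and an element \<open>neg (a ^ m)\<close> of a filter \<open>P\<close> is exactly what keeps \<open>P\<close> and \<open>a\<close>
  from lying in a common proper filter (\<open>bot_in_adjoin_iff\<close>).

  Assume the algebraic condition and let \<open>M\<close>, \<open>N\<close> be distinct maximal filters above a prime filter
  \<open>P\<close>. Pick \<open>x\<close> in \<open>M\<close> but not in \<open>N\<close>. Adjoining \<open>x\<close> to \<open>N\<close> yields \<open>bot\<close>, so some power \<open>b\<close> of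
  \<open>x\<close> and some \<open>c\<close> in \<open>N\<close> have product \<open>bot\<close>. The condition puts a join of negated powers of \<open>b\<close>
  and \<open>c\<close> into \<open>P\<close>; primality puts one of them into \<open>P\<close>, hence into \<open>M\<close> or \<open>N\<close>, which also
  contains the power itself. That is absurd.

  Conversely, suppose that \<open>a * b = bot\<close> but that no join \<open>sup (neg (a ^ m)) (neg (b ^ n))\<close> equals
  \<open>1\<close>. Since \<open>neg (a ^ n)\<close> increases with \<open>n\<close>, the elements below these joins form an ideal, which
  avoids the filter \<open>{1}\<close>. A filter maximal among those that avoid an ideal is prime
  (\<open>prime_filter_separation\<close>); this gives a prime filter \<open>P\<close> without any \<open>neg (a ^ n)\<close> or
  \<open>neg (b ^ n)\<close>. So \<open>P\<close> extends to a maximal filter containing \<open>a\<close> and to one containing \<open>b\<close>.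
  If the residuated lattice were Gelfand, these two would coincide and contain \<open>a * b = bot\<close>.
\<close>

section \<open>Arithmetic of residuated lattices\<close>

lemma le_one: "(x::'a::residuated_lattice) \<le> 1"
  by (simp add: one_eq_top)

lemma mult_right_mono_rl: "x \<le> y \<Longrightarrow> x * z \<le> y * (z::'a::residuated_lattice)"
  by (meson order.trans order_refl residuation)

lemma mult_mono_rl: "x \<le> y \<Longrightarrow> u \<le> v \<Longrightarrow> x * u \<le> y * (v::'a::residuated_lattice)"
  by (metis mult.commute mult_right_mono_rl order.trans)

lemma mult_le_left: "x * y \<le> (x::'a::residuated_lattice)"
  by (metis le_one mult.right_neutral mult_mono_rl order_refl)

text \<open>Multiplication by \<open>z\<close> is a left adjoint, so it preserves joins.\<close>

lemma sup_mult_distrib: "sup x y * z = sup (x * z) (y * (z::'a::residuated_lattice))"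
proof (rule order.antisym)
  show "sup x y * z \<le> sup (x * z) (y * z)"
    by (metis residuation sup.boundedI sup_ge1 sup_ge2)
  show "sup (x * z) (y * z) \<le> sup x y * z"
    by (simp add: mult_right_mono_rl)
qed

lemma sup_mult_sup_le: "sup x z * sup y z \<le> sup (x * y) (z::'a::residuated_lattice)"
proof -
  have "x * sup y z = sup (x * y) (x * z)"
    using sup_mult_distrib[of y z x] by (simp add: mult.commute)
  then have "sup x z * sup y z = sup (sup (x * y) (x * z)) (z * sup y z)"
    by (simp only: sup_mult_distrib[of x z])
  also have "\<dots> \<le> sup (x * y) z"
    using mult_le_left[of z x] mult_le_left[of z "sup y z"]
    by (simp add: mult.commute le_supI2)
  finally show ?thesis .
qed

lemma power_antimono_rl: "m \<le> n \<Longrightarrow> x ^ n \<le> (x::'a::residuated_lattice) ^ m"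
  using mult_le_left[of "x ^ m" "x ^ (n - m)"] by (simp flip: power_add)

lemma le_neg_iff: "z \<le> neg a \<longleftrightarrow> z * a = (bot::'a::residuated_lattice)"
  unfolding neg_def by (metis residuation bot_unique)

lemma neg_power_mono: "m \<le> n \<Longrightarrow> neg (x ^ m) \<le> neg ((x::'a::residuated_lattice) ^ n)"
proof -
  assume "m \<le> n"
  then have "neg (x ^ m) * x ^ n \<le> neg (x ^ m) * x ^ m"
    by (intro mult_mono_rl power_antimono_rl order_refl)
  also have "\<dots> = bot" using le_neg_iff by blast
  finally show ?thesis by (simp add: le_neg_iff bot_unique)
qed

section \<open>Filters\<close>

lemma filter_up: "rl_filter F \<Longrightarrow> x \<in> F \<Longrightarrow> x \<le> y \<Longrightarrow> y \<in> F"
  unfolding rl_filter_def by (metis sup.absorb2)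

lemma filter_mult: "rl_filter F \<Longrightarrow> x \<in> F \<Longrightarrow> y \<in> F \<Longrightarrow> x * y \<in> F"
  unfolding rl_filter_def by blast

lemma filter_one: "rl_filter F \<Longrightarrow> 1 \<in> F"
  by (metis rl_filter_def ex_in_conv filter_up le_one)

lemma filter_power: "rl_filter F \<Longrightarrow> x \<in> F \<Longrightarrow> x ^ n \<in> F"
  by (induction n) (auto intro: filter_one filter_mult)

lemma rl_filterI:
  assumes "x0 \<in> F" "\<And>x y. x \<in> F \<Longrightarrow> y \<in> F \<Longrightarrow> x * y \<in> F" "\<And>x y. x \<in> F \<Longrightarrow> x \<le> y \<Longrightarrow> y \<in> F"
  shows "rl_filter F"
  unfolding rl_filter_def using assms sup_ge1 by blast

lemma proper_filter_iff: "proper_filter F \<longleftrightarrow> rl_filter F \<and> bot \<notin> F"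
  unfolding proper_filter_def by (metis UNIV_I UNIV_eq_I bot_least filter_up)

lemma proper_filter_neg:
  "proper_filter F \<Longrightarrow> a \<in> F \<Longrightarrow> neg a \<notin> F"
  by (metis proper_filter_iff filter_mult le_neg_iff order_refl)

text \<open>
  The inequality \<open>sup_mult_sup_le\<close> makes \<open>{x. sup x z \<in> F}\<close> closed under multiplication; applied in
  each argument in turn, this closes the condition under powers.
\<close>

lemma filter_sup_power:
  assumes F: "rl_filter F" and "sup x y \<in> F"
  shows "sup (x ^ m) (y ^ n) \<in> F"
proof -
  have left: "sup (u ^ k) v \<in> F" if "sup u v \<in> F" for u v k
  proof (induction k)
    case 0
    show ?case using F by (metis filter_one filter_up power_0 sup_ge1)
  next
    case (Suc k)
    then show ?case
      using filter_up[OF F filter_mult[OF F that Suc] sup_mult_sup_le] by simp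
  qed
  have "sup y (x ^ m) \<in> F"
    using left[OF assms(2)] by (simp only: sup_commute)
  from left[OF this] show ?thesis by (simp only: sup_commute)
qed

text \<open>The filter generated by \<open>F\<close> and \<open>x\<close>.\<close>

definition adjoin :: "'a::residuated_lattice set \<Rightarrow> 'a \<Rightarrow> 'a set" where
  "adjoin F x = {z. \<exists>p\<in>F. \<exists>k. p * x ^ k \<le> z}"

lemma adjoin_filter:
  assumes F: "rl_filter F"
  shows "rl_filter (adjoin F x)"
proof (rule rl_filterI)
  show "1 \<in> adjoin F x"
    unfolding adjoin_def using filter_one[OF F] le_one by blast
  fix u v assume u: "u \<in> adjoin F x"
  show "v \<in> adjoin F x" if "u \<le> v"
    using u that unfolding adjoin_def by (blast intro: order.trans)
  assume "v \<in> adjoin F x"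
  with u obtain p q k l where "p \<in> F" "q \<in> F" "p * x ^ k \<le> u" "q * x ^ l \<le> v"
    unfolding adjoin_def by blast
  moreover from this have "(p * q) * x ^ (k + l) \<le> u * v"
    using mult_mono_rl[of "p * x ^ k" u "q * x ^ l" v] by (simp add: power_add ac_simps)
  ultimately show "u * v \<in> adjoin F x"
    unfolding adjoin_def using filter_mult[OF F] by blast
qed

lemma subset_adjoin: "F \<subseteq> adjoin F x"
  unfolding adjoin_def using mult_le_left by blast

lemma in_adjoin: "rl_filter F \<Longrightarrow> x \<in> adjoin F x"
  unfolding adjoin_def by (auto intro!: bexI[of _ 1] exI[of _ 1] filter_one)

lemma bot_in_adjoin_iff:
  "rl_filter F \<Longrightarrow> bot \<in> adjoin F x \<longleftrightarrow> (\<exists>k. neg (x ^ k) \<in> F)"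
  unfolding adjoin_def mem_Collect_eq bot_unique le_neg_iff[symmetric]
  by (blast intro: filter_up)

section \<open>Separation of filters from ideals\<close>

lemma ex_maximal_disjoint_filter:
  assumes "rl_filter F" "F \<inter> I = {}"
  shows "\<exists>P. rl_filter P \<and> F \<subseteq> P \<and> P \<inter> I = {} \<and>
    (\<forall>Q. rl_filter Q \<and> P \<subseteq> Q \<and> Q \<inter> I = {} \<longrightarrow> Q = P)"
proof -
  let ?A = "{Q. rl_filter Q \<and> F \<subseteq> Q \<and> Q \<inter> I = {}}"
  have "\<exists>P\<in>?A. \<forall>Q\<in>?A. P \<subseteq> Q \<longrightarrow> Q = P"
  proof (rule subset_Zorn_nonempty)
    show "?A \<noteq> {}" using assms by blast
    fix C assume ne: "C \<noteq> {}" and C: "subset.chain ?A C"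
    have filt: "rl_filter Q" if "Q \<in> C" for Q
      using C that unfolding subset.chain_def by blast
    have total: "Q \<subseteq> R \<or> R \<subseteq> Q" if "Q \<in> C" "R \<in> C" for Q R
      using C that unfolding subset.chain_def by blast
    obtain Q where "Q \<in> C" using ne by blast
    have "rl_filter (\<Union>C)"
    proof (rule rl_filterI)
      show "1 \<in> \<Union>C" using \<open>Q \<in> C\<close> filt filter_one by blast
      fix x y assume x: "x \<in> \<Union>C"
      show "y \<in> \<Union>C" if "x \<le> y" using x that filt filter_up by blast
      assume "y \<in> \<Union>C"
      with x obtain Q R where "Q \<in> C" "R \<in> C" "x \<in> Q" "y \<in> R" by blast
      then obtain S where "S \<in> C" "x \<in> S" "y \<in> S" using total by blast
      then show "x * y \<in> \<Union>C" using filt filter_mult by blast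
    qed
    moreover have "F \<subseteq> \<Union>C" "\<Union>C \<inter> I = {}"
      using C \<open>Q \<in> C\<close> unfolding subset.chain_def by blast+
    ultimately show "\<Union>C \<in> ?A" by blast
  qed
  then obtain P where P: "P \<in> ?A" and max: "\<forall>Q\<in>?A. P \<subseteq> Q \<longrightarrow> Q = P"
    by (rule bexE)
  have "Q = P" if "rl_filter Q" "P \<subseteq> Q" "Q \<inter> I = {}" for Q
    using max P that by auto
  with P show ?thesis by auto
qed

lemma ex_maximal_filter:
  assumes "proper_filter F"
  shows "\<exists>M. maximal_filter M \<and> F \<subseteq> M"
proof -
  \<comment> \<open>A filter is proper exactly if it avoids the ideal \<open>{bot}\<close>.\<close>
  obtain M where "rl_filter M" "F \<subseteq> M" "M \<inter> {bot} = {}"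
    "\<forall>Q. rl_filter Q \<and> M \<subseteq> Q \<and> Q \<inter> {bot} = {} \<longrightarrow> Q = M"
    using ex_maximal_disjoint_filter[of F "{bot}"] assms unfolding proper_filter_iff by auto
  then show ?thesis unfolding maximal_filter_def proper_filter_iff by auto
qed

text \<open>
  If neither \<open>x\<close> nor \<open>y\<close> is in a filter \<open>P\<close> maximal among those avoiding the ideal \<open>I\<close>, then \<open>I\<close>
  contains some \<open>p * x ^ k\<close> and \<open>q * y ^ l\<close> with \<open>p\<close>, \<open>q\<close> in \<open>P\<close>. Their join bounds
  \<open>(p * q) * sup (x ^ k) (y ^ l)\<close>, which would be in \<open>P\<close> if \<open>sup x y\<close> were.
\<close>

lemma prime_filter_separation:
  assumes F: "rl_filter F" and disj: "F \<inter> I = {}" and ne: "I \<noteq> {}"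
    and down: "\<And>x y. y \<in> I \<Longrightarrow> x \<le> y \<Longrightarrow> x \<in> I"
    and sup: "\<And>x y. x \<in> I \<Longrightarrow> y \<in> I \<Longrightarrow> sup x y \<in> I"
  shows "\<exists>P. prime_filter P \<and> F \<subseteq> P \<and> P \<inter> I = {}"
proof -
  obtain P where P: "rl_filter P" "F \<subseteq> P" "P \<inter> I = {}"
    and max: "\<And>Q. rl_filter Q \<Longrightarrow> P \<subseteq> Q \<Longrightarrow> Q \<inter> I = {} \<Longrightarrow> Q = P"
    using ex_maximal_disjoint_filter[OF F disj] by auto
  have meets: "\<exists>p\<in>P. \<exists>k. p * x ^ k \<in> I" if "x \<notin> P" for x
  proof -
    have "adjoin P x \<inter> I \<noteq> {}"
      using max[OF adjoin_filter[OF P(1)] subset_adjoin] in_adjoin[OF P(1), of x] that by blast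
    then show ?thesis unfolding adjoin_def using down by blast
  qed
  have "x \<in> P \<or> y \<in> P" if xy: "sup x y \<in> P" for x y
  proof (rule ccontr)
    assume "\<not> (x \<in> P \<or> y \<in> P)"
    then obtain p k q l where p: "p \<in> P" "p * x ^ k \<in> I" and q: "q \<in> P" "q * y ^ l \<in> I"
      using meets by blast
    have "p * q * sup (x ^ k) (y ^ l) = sup (p * x ^ k * q) (q * y ^ l * p)"
      using sup_mult_distrib[of "x ^ k" "y ^ l" "p * q"] by (simp add: ac_simps)
    also have "\<dots> \<le> sup (p * x ^ k) (q * y ^ l)"
      by (rule sup_mono) (rule mult_le_left)+
    finally have "p * q * sup (x ^ k) (y ^ l) \<in> I"
      using down sup p(2) q(2) by blast
    moreover have "p * q * sup (x ^ k) (y ^ l) \<in> P"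
      using filter_mult[OF P(1)] filter_sup_power[OF P(1) xy] p(1) q(1) by blast
    ultimately show False using P(3) by blast
  qed
  moreover have "P \<noteq> UNIV" using P(3) ne by blast
  ultimately show ?thesis using P unfolding prime_filter_def proper_filter_def by blast
qed

section \<open>The Gelfand property\<close>

text \<open>
  Maximality of \<open>N\<close> says that any \<open>x\<close> outside \<open>N\<close> generates \<open>bot\<close> together with \<open>N\<close>; the witness
  pair consists of a power of such an \<open>x\<close> from \<open>M\<close> and its negation in \<open>N\<close>.
\<close>

lemma maximal_filters_separated:
  assumes M: "maximal_filter M" and N: "maximal_filter N" and "M \<noteq> N"
  shows "\<exists>a\<in>M. \<exists>b\<in>N. a * b = bot"
proof -
  have fM: "rl_filter M" and fN: "rl_filter N"
    using M N unfolding maximal_filter_def proper_filter_def by auto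
  obtain x where x: "x \<in> M" "x \<notin> N"
    using assms unfolding maximal_filter_def by blast
  have "\<not> proper_filter (adjoin N x)"
    using N subset_adjoin[of N x] in_adjoin[OF fN, of x] x(2)
    unfolding maximal_filter_def by blast
  then obtain k where "neg (x ^ k) \<in> N"
    using adjoin_filter[OF fN] bot_in_adjoin_iff[OF fN] unfolding proper_filter_iff by blast
  moreover have "x ^ k * neg (x ^ k) = bot"
    by (metis le_neg_iff mult.commute order_refl)
  ultimately show ?thesis using filter_power[OF fM x(1)] by blast
qed

lemma ex_maximal_filter_containing:
  assumes P: "rl_filter P" and "\<And>k. neg (a ^ k) \<notin> P"
  shows "\<exists>M. maximal_filter M \<and> P \<subseteq> M \<and> a \<in> M"
proof -
  have "proper_filter (adjoin P a)"
    using assms adjoin_filter bot_in_adjoin_iff unfolding proper_filter_iff by blast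
  then show ?thesis
    using ex_maximal_filter subset_adjoin[of P a] in_adjoin[OF P, of a] by blast
qed

lemma gelfand_imp_neg_powers:
  fixes a b :: "'a::residuated_lattice"
  assumes G: "gelfand TYPE('a)" and ab: "a * b = bot"
  shows "\<exists>m n. m > 0 \<and> n > 0 \<and> sup (neg (a ^ m)) (neg (b ^ n)) = 1"
proof (rule ccontr)
  assume no: "\<not> ?thesis"
  \<comment> \<open>One exponent for both elements suffices, because negated powers increase with the exponent;
    this also makes the set below directed. The successor keeps the exponent positive.\<close>
  define j where "j n = sup (neg (a ^ Suc n)) (neg (b ^ Suc n))" for n
  define I where "I = {x. \<exists>n. x \<le> j n}"
  have j_mono: "j m \<le> j n" if "m \<le> n" for m n
    unfolding j_def using that by (intro sup_mono neg_power_mono) auto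
  have "\<exists>P. prime_filter P \<and> {1} \<subseteq> P \<and> P \<inter> I = {}"
  proof (rule prime_filter_separation)
    show "rl_filter {1::'a}" by (rule rl_filterI[of 1]) (auto intro: order.antisym le_one)
    have "\<not> 1 \<le> j n" for n
      using no unfolding j_def by (metis le_one order.antisym zero_less_Suc)
    then show "{1} \<inter> I = {}" unfolding I_def by blast
    show "I \<noteq> {}" unfolding I_def by blast
    show "x \<in> I" if "y \<in> I" "x \<le> y" for x y
      using that unfolding I_def by (blast intro: order.trans)
    show "sup x y \<in> I" if xy: "x \<in> I" "y \<in> I" for x y
    proof -
      obtain m n where "x \<le> j m" "y \<le> j n" using xy unfolding I_def by blast
      then have "sup x y \<le> j (max m n)"
        by (meson j_mono max.cobounded1 max.cobounded2 order.trans sup.boundedI)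
      then show ?thesis unfolding I_def by blast
    qed
  qed
  then obtain P where P: "prime_filter P" "P \<inter> I = {}" by blast
  then have fP: "rl_filter P" unfolding prime_filter_def proper_filter_def by blast
  have "neg (a ^ k) \<le> j k" "neg (b ^ k) \<le> j k" for k
    unfolding j_def
    by (meson le_SucI order_refl neg_power_mono le_supI1 le_supI2)+
  then have "neg (a ^ k) \<notin> P" "neg (b ^ k) \<notin> P" for k
    using P(2) unfolding I_def by blast+
  then obtain M N where M: "maximal_filter M" "P \<subseteq> M" "a \<in> M" and N: "maximal_filter N" "P \<subseteq> N" "b \<in> N"
    using ex_maximal_filter_containing[OF fP] by metis
  then have "M = N" using G P(1) unfolding gelfand_def by blast
  then have "proper_filter M" "a * b \<in> M"
    using M N filter_mult unfolding maximal_filter_def proper_filter_def by blast+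
  then show False using ab unfolding proper_filter_iff by simp
qed

lemma neg_powers_imp_gelfand:
  assumes neg: "\<And>a b :: 'a::residuated_lattice. a * b = bot \<Longrightarrow>
      \<exists>m n. sup (neg (a ^ m)) (neg (b ^ n)) = 1"
  shows "gelfand TYPE('a)"
  unfolding gelfand_def
proof (intro allI impI)
  fix P :: "'a set" assume P: "prime_filter P"
  have uniq: "M = N" if M: "maximal_filter M" "P \<subseteq> M" and N: "maximal_filter N" "P \<subseteq> N" for M N
  proof (rule ccontr)
    assume "M \<noteq> N"
    then obtain a b where ab: "a \<in> M" "b \<in> N" "a * b = bot"
      using maximal_filters_separated M(1) N(1) by blast
    obtain m n where "sup (neg (a ^ m)) (neg (b ^ n)) = 1" using neg[OF ab(3)] by blast
    then have "neg (a ^ m) \<in> P \<or> neg (b ^ n) \<in> P"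
      using P filter_one unfolding prime_filter_def proper_filter_def by metis
    then have "neg (a ^ m) \<in> M \<or> neg (b ^ n) \<in> N" using M(2) N(2) by blast
    moreover have "proper_filter M" "proper_filter N"
      using M(1) N(1) unfolding maximal_filter_def by auto
    ultimately show False
      using ab(1,2) filter_power proper_filter_neg unfolding proper_filter_def by metis
  qed
  show "\<exists>!M. maximal_filter M \<and> P \<subseteq> M"
    using uniq ex_maximal_filter[of P] P unfolding prime_filter_def by blast
qed

theorem theorem3p5:
  shows "gelfand TYPE('a::residuated_lattice) \<longleftrightarrow>
    (\<forall>a b :: 'a. a * b = bot \<longrightarrow>
      (\<exists>m n :: nat. m > 0 \<and> n > 0 \<and> sup (neg (a ^ m)) (neg (b ^ n)) = 1))"
  using gelfand_imp_neg_powers neg_powers_imp_gelfand by blast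

end
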